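(* Let $y\in\mathbb{R}^n$, $X\in\mathbb{R}^{n\times p}$, and let $$\lambda_0 = \max_{j\in\{1,\dots,J\}} \frac{\|X_{\cdot,j}^{\mathsf T}\,y\|_2}{n K_j}.$$ For every $\lambda > \lambda_0$ and every real matrix $B$ with $p$ columns satisfying $X^{\mathsf T}X\succeq\lambda B^{\mathsf T}B$, the group GMC problem $$\operatorname*{minimize}_{\beta\in\mathbb{R}^p}\ \frac{1}{2n}\|y - X\beta\|_2^2 + \lambda\,\Phi_B(\beta)$$ has the unique solution $\hat\beta(\lambda) = 0\in\mathbb{R}^p$.
   Context: The $p$ coordinates are partitioned into $J$ groups of sizes $p_1,\dots,p_J$ with $\sum_{j=1}^J p_j = p$, and we write $\beta = (\beta_1^{\mathsf T},\dots,\beta_J^{\mathsf T})^{\mathsf T}\in\mathbb{R}^p$ with $\beta_j\in\mathbb{R}^{p_j}$ (similarly for $v\in\mathbb{R}^p$). $X_{\cdot,j}\in\mathbb{R}^{n\times p_j}$ is the submatrix of $X$ consisting of the columns in the $j$-th group. $K_1,\dots,K_J$ are positive weights. For a real matrix $B$ with $p$ columns, the group GMC (generalized minimax concave) penalty $\Phi_B:\mathbb{R}^p\to\mathbb{R}$ is $$\Phi_B(\beta) = \sum_{j=1}^J K_j\|\beta_j\|_2 - \min_{v\in\mathbb{R}^p}\left\{\sum_{j=1}^J K_j\|v_j\|_2 + \frac{1}{2n}\|B(\beta - v)\|_2^2\right\}.$$ $M\succeq N$ means that $M-N$ is positive semidefinite. *)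

theory Defs
  imports "HOL-Analysis.Analysis"
begin

text \<open>
  Coordinates are indexed by the finite type \<open>'p\<close> and groups by the finite type \<open>'j\<close>; the
  partition is the map \<open>g\<close> sending a coordinate to its group. The \<open>j\<close>-th block of \<open>v\<close> consists
  of the components \<open>v $ i\<close> with \<open>g i = j\<close>, so its Euclidean norm is an \<open>L2_set\<close> over that fibre.
\<close>

definition group_norm :: "('p::finite \<Rightarrow> 'j) \<Rightarrow> 'j \<Rightarrow> real ^ 'p \<Rightarrow> real"
  where "group_norm g j v = L2_set (\<lambda>i. v $ i) {i. g i = j}"

definition weighted_group_norm :: "('p::finite \<Rightarrow> 'j::finite) \<Rightarrow> ('j \<Rightarrow> real) \<Rightarrow> real ^ 'p \<Rightarrow> real"
  where "weighted_group_norm g K v = (\<Sum>j\<in>UNIV. K j * group_norm g j v)"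

text \<open>
  The sample size \<open>n\<close> is a separate argument because \<open>B\<close> may have any number of rows.
\<close>

definition gmc_inner ::
  "nat \<Rightarrow> ('p::finite \<Rightarrow> 'j::finite) \<Rightarrow> ('j \<Rightarrow> real) \<Rightarrow> real ^ 'p ^ 'm::finite
    \<Rightarrow> real ^ 'p \<Rightarrow> real ^ 'p \<Rightarrow> real"
  where "gmc_inner n g K B \<beta> v =
    weighted_group_norm g K v + 1 / (2 * real n) * (norm (B *v (\<beta> - v)))\<^sup>2"

text \<open>The infimum is a minimum when the weights are positive; see \<open>gmc_inner_attains_INF\<close> below.\<close>

definition group_gmc ::
  "nat \<Rightarrow> ('p::finite \<Rightarrow> 'j::finite) \<Rightarrow> ('j \<Rightarrow> real) \<Rightarrow> real ^ 'p ^ 'm::finite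
    \<Rightarrow> real ^ 'p \<Rightarrow> real"
  where "group_gmc n g K B \<beta> = weighted_group_norm g K \<beta> - (INF v. gmc_inner n g K B \<beta> v)"

definition gmc_objective ::
  "real ^ 'n::finite \<Rightarrow> real ^ 'p ^ 'n \<Rightarrow> ('p::finite \<Rightarrow> 'j::finite) \<Rightarrow> ('j \<Rightarrow> real)
    \<Rightarrow> real \<Rightarrow> real ^ 'p ^ 'm::finite \<Rightarrow> real ^ 'p \<Rightarrow> real"
  where "gmc_objective y X g K lam B \<beta> =
    1 / (2 * real CARD('n)) * (norm (y - X *v \<beta>))\<^sup>2 + lam * group_gmc CARD('n) g K B \<beta>"

text \<open>The transpose of the submatrix of \<open>X\<close> on group \<open>j\<close>, applied to \<open>y\<close>, is the \<open>j\<close>-th block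
  of \<open>transpose X *v y\<close>.\<close>

definition gmc_lambda0 ::
  "real ^ 'n::finite \<Rightarrow> real ^ 'p ^ 'n \<Rightarrow> ('p::finite \<Rightarrow> 'j::finite) \<Rightarrow> ('j \<Rightarrow> real) \<Rightarrow> real"
  where "gmc_lambda0 y X g K =
    (MAX j. group_norm g j (transpose X *v y) / (real CARD('n) * K j))"

definition psd :: "real ^ 'p ^ 'p::finite \<Rightarrow> bool"
  where "psd M \<longleftrightarrow> transpose M = M \<and> (\<forall>x. 0 \<le> x \<bullet> (M *v x))"

lemma gmc_inner_attains_INF:
  fixes B :: "real ^ 'p::finite ^ 'm::finite" and g :: "'p \<Rightarrow> 'j::finite"
  assumes "\<And>j. 0 < K j"
  shows "\<exists>v. gmc_inner n g K B \<beta> v = (INF w. gmc_inner n g K B \<beta> w)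
    \<and> (\<forall>w. gmc_inner n g K B \<beta> v \<le> gmc_inner n g K B \<beta> w)"
proof -
  let ?h = "gmc_inner n g K B \<beta>"
  let ?S = "{v. ?h v \<le> ?h 0}"
  have cont: "continuous_on UNIV ?h"
    unfolding gmc_inner_def weighted_group_norm_def group_norm_def L2_set_def
    by (intro continuous_intros matrix_vector_mult_linear_continuous_on
        continuous_on_compose2[OF matrix_vector_mult_linear_continuous_on[of UNIV B]]) auto
  have coord: "K (g i) * \<bar>v $ i\<bar> \<le> ?h v" for v i
  proof -
    have "\<bar>v $ i\<bar> \<le> group_norm g (g i) v"
      using member_le_L2_set[of "{k. g k = g i}" i "\<lambda>k. \<bar>v $ k\<bar>"]
      by (simp add: group_norm_def L2_set_def)
    then have "K (g i) * \<bar>v $ i\<bar> \<le> K (g i) * group_norm g (g i) v"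
      using assms by (simp add: less_imp_le mult_left_mono)
    also have "\<dots> \<le> weighted_group_norm g K v"
      unfolding weighted_group_norm_def
      by (rule member_le_sum) (auto simp: assms less_imp_le group_norm_def)
    also have "\<dots> \<le> ?h v" by (simp add: gmc_inner_def)
    finally show ?thesis .
  qed
  have "norm v \<le> (\<Sum>i\<in>UNIV. ?h 0 / K (g i))" if "v \<in> ?S" for v
  proof -
    have "\<bar>v $ i\<bar> \<le> ?h 0 / K (g i)" for i
      using coord[of i v] that assms[of "g i"] by (simp add: field_simps)
    then have "(\<Sum>i\<in>UNIV. \<bar>v $ i\<bar>) \<le> (\<Sum>i\<in>UNIV. ?h 0 / K (g i))"
      by (intro sum_mono)
    then show ?thesis
      using norm_le_l1_cart[of v] by linarith
  qed
  then have "bounded ?S" by (auto simp: bounded_iff)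
  moreover have "closed ?S"
    using cont by (intro closed_Collect_le continuous_intros)
  ultimately have "compact ?S" by (simp add: compact_eq_bounded_closed)
  then obtain v where v: "?h v \<le> ?h 0" "\<And>w. ?h w \<le> ?h 0 \<Longrightarrow> ?h v \<le> ?h w"
    using continuous_attains_inf[of ?S ?h] continuous_on_subset[OF cont] by auto
  then have min: "?h v \<le> ?h w" for w by (meson linear order_trans)
  then have "(INF w. ?h w) = ?h v" by (intro cInf_eq_minimum) auto
  then show ?thesis using min by metis
qed

end

theory Submission
  imports Defs
begin

text \<open>
  Testing the inner minimum at \<open>v = 0\<close> gives
  \<open>\<Phi>\<^sub>B(\<beta>) \<ge> \<Sum>\<^sub>j K\<^sub>j \<parallel>\<beta>\<^sub>j\<parallel> - \<parallel>B\<beta>\<parallel>\<^sup>2 / (2n)\<close>. Since \<open>\<parallel>X\<beta>\<parallel>\<^sup>2\<close> absorbs \<open>\<lambda> \<parallel>B\<beta>\<parallel>\<^sup>2\<close>, the objective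
  at \<open>\<beta>\<close> exceeds its value at \<open>0\<close> by at least \<open>\<lambda> \<Sum>\<^sub>j K\<^sub>j \<parallel>\<beta>\<^sub>j\<parallel> - \<langle>X\<^sup>T y, \<beta>\<rangle> / n\<close>, and by the blockwise
  Cauchy--Schwarz inequality this is at least \<open>(\<lambda> - \<lambda>\<^sub>0) \<Sum>\<^sub>j K\<^sub>j \<parallel>\<beta>\<^sub>j\<parallel>\<close>.
\<close>

lemma group_norm_nonneg: "0 \<le> group_norm g j v"
  by (simp add: group_norm_def)

lemma weighted_group_norm_zero: "weighted_group_norm g K 0 = 0"
  by (simp add: weighted_group_norm_def group_norm_def L2_set_def)

lemma weighted_group_norm_nonneg:
  assumes "\<And>j. 0 < K j"
  shows "0 \<le> weighted_group_norm g K v"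
  unfolding weighted_group_norm_def
  by (intro sum_nonneg mult_nonneg_nonneg group_norm_nonneg less_imp_le assms)

text \<open>Source of strictness, hence of uniqueness: a nonzero coordinate \<open>i\<close> makes
  the term of its own group \<open>g i\<close> positive, and no other term is negative.\<close>

lemma weighted_group_norm_pos:
  assumes "\<And>j. 0 < K j" and "v \<noteq> 0"
  shows "0 < weighted_group_norm g K v"
proof -
  obtain i where i: "v $ i \<noteq> 0"
    using \<open>v \<noteq> 0\<close> by (auto simp: vec_eq_iff)
  then have "group_norm g (g i) v \<noteq> 0"
    by (auto simp: group_norm_def L2_set_eq_0_iff)
  then have "0 < K (g i) * group_norm g (g i) v"
    using assms(1) group_norm_nonneg[of g "g i" v] by simp
  also have "\<dots> \<le> weighted_group_norm g K v"
    unfolding weighted_group_norm_def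
    by (rule member_le_sum) (auto simp: assms less_imp_le group_norm_nonneg)
  finally show ?thesis .
qed

lemma inner_le_sum_group_norm:
  fixes g :: "'p::finite \<Rightarrow> 'j::finite"
  shows "u \<bullet> v \<le> (\<Sum>j\<in>UNIV. group_norm g j u * group_norm g j v)"
proof -
  \<comment> \<open>The fibres of \<open>g\<close> partition the coordinates, so the inner product
    splits into blocks and Cauchy-Schwarz applies to each.\<close>
  have "u \<bullet> v = (\<Sum>j\<in>UNIV. \<Sum>i\<in>{i. g i = j}. u $ i * v $ i)"
    by (simp add: inner_vec_def sum.group[of UNIV UNIV g, simplified])
  also have "\<dots> \<le> (\<Sum>j\<in>UNIV. group_norm g j u * group_norm g j v)"
  proof (rule sum_mono)
    fix j
    have "(\<Sum>i\<in>{i. g i = j}. u $ i * v $ i) \<le> (\<Sum>i\<in>{i. g i = j}. \<bar>u $ i\<bar> * \<bar>v $ i\<bar>)"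
      by (intro sum_mono) (metis abs_ge_self abs_mult)
    also have "\<dots> \<le> group_norm g j u * group_norm g j v"
      unfolding group_norm_def by (rule L2_set_mult_ineq)
    finally show "(\<Sum>i\<in>{i. g i = j}. u $ i * v $ i) \<le> group_norm g j u * group_norm g j v" .
  qed
  finally show ?thesis .
qed

lemma group_norm_le_gmc_lambda0:
  fixes y :: "real ^ 'n::finite"
  assumes "0 < K j"
  shows "group_norm g j (transpose X *v y) \<le> real CARD('n) * gmc_lambda0 y X g K * K j"
proof -
  have "group_norm g j (transpose X *v y) / (real CARD('n) * K j) \<le> gmc_lambda0 y X g K"
    unfolding gmc_lambda0_def by (rule Max_ge) auto
  then show ?thesis
    using assms by (simp add: pos_divide_le_eq mult_ac)
qed

text \<open>Makes every admissible \<open>lam\<close> nonnegative, so that the lower bound for the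
  penalty may be multiplied by it.\<close>

lemma gmc_lambda0_nonneg:
  fixes y :: "real ^ 'n::finite"
  assumes "\<And>j. 0 < K j"
  shows "0 \<le> gmc_lambda0 y X g K"
proof -
  \<comment> \<open>\<open>undefined\<close> serves as an arbitrary group; only the positivity of
    its weight matters.\<close>
  have "0 \<le> real CARD('n) * gmc_lambda0 y X g K * K undefined"
    using group_norm_le_gmc_lambda0[OF assms] group_norm_nonneg by (rule order_trans[rotated])
  then show ?thesis
    using assms[of undefined] by (simp add: zero_le_mult_iff)
qed

lemma inner_le_gmc_lambda0:
  fixes y :: "real ^ 'n::finite"
  assumes "\<And>j. 0 < K j"
  shows "y \<bullet> (X *v \<beta>) \<le> real CARD('n) * gmc_lambda0 y X g K * weighted_group_norm g K \<beta>"
proof -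
  have "y \<bullet> (X *v \<beta>) = (transpose X *v y) \<bullet> \<beta>"
    by (simp add: dot_lmul_matrix)
  also have "\<dots> \<le> (\<Sum>j\<in>UNIV. group_norm g j (transpose X *v y) * group_norm g j \<beta>)"
    by (rule inner_le_sum_group_norm)
  also have "\<dots> \<le> (\<Sum>j\<in>UNIV. real CARD('n) * gmc_lambda0 y X g K * K j * group_norm g j \<beta>)"
    by (intro sum_mono mult_right_mono group_norm_le_gmc_lambda0 group_norm_nonneg assms)
  also have "\<dots> = real CARD('n) * gmc_lambda0 y X g K * weighted_group_norm g K \<beta>"
    by (simp add: weighted_group_norm_def sum_distrib_left mult_ac)
  finally show ?thesis .
qed

lemma group_gmc_ge:
  assumes "\<And>j. 0 < K j"
  shows "weighted_group_norm g K \<beta> - 1 / (2 * real n) * (norm (B *v \<beta>))\<^sup>2 \<le> group_gmc n g K B \<beta>"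
proof -
  \<comment> \<open>Attainment of the minimum spares a separate proof that the range is bounded
    below.\<close>
  have "(INF w. gmc_inner n g K B \<beta> w) \<le> gmc_inner n g K B \<beta> 0"
    using gmc_inner_attains_INF[of K n g B \<beta>, OF assms] by metis
  then show ?thesis
    by (simp add: group_gmc_def gmc_inner_def weighted_group_norm_zero)
qed

text \<open>Both summands of the inner objective are nonnegative and vanish at \<open>w = 0\<close>,
  so the inner minimum is zero.\<close>

lemma group_gmc_zero:
  assumes "\<And>j. 0 < K j"
  shows "group_gmc n g K B 0 = 0"
proof -
  have "0 \<le> gmc_inner n g K B 0 w" for w
    by (simp add: gmc_inner_def weighted_group_norm_nonneg assms)
  moreover have "gmc_inner n g K B 0 0 = 0"
    by (simp add: gmc_inner_def weighted_group_norm_zero)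
  ultimately have "(INF w. gmc_inner n g K B 0 w) = 0"
    by (intro cInf_eq_minimum) (auto intro: rev_image_eqI)
  then show ?thesis
    by (simp add: group_gmc_def weighted_group_norm_zero)
qed

lemma inner_gram:
  fixes A :: "real ^ 'p::finite ^ 'm::finite"
  shows "v \<bullet> ((transpose A ** A) *v v) = (norm (A *v v))\<^sup>2"
  by (metis dot_lmul_matrix inner_commute matrix_vector_mul_assoc power2_norm_eq_inner
      transpose_matrix_vector)

text \<open>The matrix condition enters here: evaluate the quadratic form at \<open>v\<close> and
  turn each Gram matrix into a squared norm.\<close>

lemma psd_gram_diff_norm_le:
  fixes X :: "real ^ 'p::finite ^ 'n::finite" and B :: "real ^ 'p ^ 'm::finite"
  assumes "psd (transpose X ** X - lam *\<^sub>R (transpose B ** B))"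
  shows "lam * (norm (B *v v))\<^sup>2 \<le> (norm (X *v v))\<^sup>2"
proof -
  have "0 \<le> v \<bullet> ((transpose X ** X - lam *\<^sub>R (transpose B ** B)) *v v)"
    using assms by (simp add: psd_def)
  then show ?thesis
    by (simp add: matrix_vector_mult_diff_rdistrib inner_diff_right inner_gram
        scaleR_matrix_vector_assoc[symmetric])
qed

lemma gmc_objective_zero_less:
  fixes y :: "real ^ 'n::finite"
  assumes K: "\<And>j. 0 < K j"
    and lam: "gmc_lambda0 y X g K < lam"
    and psd: "psd (transpose X ** X - lam *\<^sub>R (transpose B ** B))"
    and "\<beta> \<noteq> 0"
  shows "gmc_objective y X g K lam B 0 < gmc_objective y X g K lam B \<beta>"
proof -
  define n where "n = real CARD('n)"
  define N where "N = weighted_group_norm g K \<beta>"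
  have n: "n > 0"
    by (simp add: n_def)
  have "0 \<le> lam"
    using gmc_lambda0_nonneg[of K y X g, OF K] lam by simp
  then have "lam * (N - 1 / (2 * n) * (norm (B *v \<beta>))\<^sup>2) \<le> lam * group_gmc CARD('n) g K B \<beta>"
    unfolding N_def n_def by (intro mult_left_mono group_gmc_ge K)
  \<comment> \<open>With this scaling the quadratic loss term covers what the penalty bound
    subtracts.\<close>
  moreover have "1 / (2 * n) * (lam * (norm (B *v \<beta>))\<^sup>2) \<le> 1 / (2 * n) * (norm (X *v \<beta>))\<^sup>2"
    using n by (intro mult_left_mono psd_gram_diff_norm_le[OF psd]) simp
  moreover have "1 / n * (y \<bullet> (X *v \<beta>)) \<le> gmc_lambda0 y X g K * N"
    using inner_le_gmc_lambda0[of K y X \<beta> g, OF K] n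
    by (simp add: n_def N_def pos_divide_le_eq mult_ac)
  \<comment> \<open>The one strict link of the chain: \<open>N > 0\<close> because
    \<open>\<beta> \<noteq> 0\<close>.\<close>
  moreover have "gmc_lambda0 y X g K * N < lam * N"
    using lam weighted_group_norm_pos[of K \<beta> g, OF K \<open>\<beta> \<noteq> 0\<close>] by (simp add: N_def)
  moreover have "1 / (2 * n) * (norm (y - X *v \<beta>))\<^sup>2 =
      1 / (2 * n) * (norm y)\<^sup>2 - 1 / n * (y \<bullet> (X *v \<beta>)) + 1 / (2 * n) * (norm (X *v \<beta>))\<^sup>2"
    using n by (simp add: power2_norm_eq_inner inner_diff inner_commute field_simps)
  ultimately have "1 / (2 * n) * (norm y)\<^sup>2
      < 1 / (2 * n) * (norm (y - X *v \<beta>))\<^sup>2 + lam * group_gmc CARD('n) g K B \<beta>"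
    by (simp add: right_diff_distrib)
  then show ?thesis
    by (simp add: gmc_objective_def group_gmc_zero[OF K] n_def)
qed

theorem theorem2p2:
  fixes y :: "real ^ 'n::finite"
    and X :: "real ^ 'p::finite ^ 'n"
    and g :: "'p \<Rightarrow> 'j::finite"
    and K :: "'j \<Rightarrow> real"
    and B :: "real ^ 'p ^ 'm::finite"
    and lam :: real
  assumes "\<And>j. 0 < K j"
    and "gmc_lambda0 y X g K < lam"
    and "psd (transpose X ** X - lam *\<^sub>R (transpose B ** B))"
  shows "\<forall>\<beta>. is_arg_min (gmc_objective y X g K lam B) (\<lambda>_. True) \<beta> \<longleftrightarrow> \<beta> = 0"
  \<comment> \<open>The strict inequality works both ways: nothing beats \<open>0\<close>, and
    \<open>0\<close> beats every other point.\<close>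
  using gmc_objective_zero_less[OF assms] unfolding is_arg_min_def
  by (metis less_asym less_irrefl)

end
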